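(* Let $\mathsf{C}$ be a category with binary coproducts, $(T,\mu,\eta)$ a monad on $\mathsf{C}$, and $F:\mathsf{C}\to\mathsf{C}$ a functor lifting to $\overline{F}:\mathcal{K}l(T)\to\mathcal{K}l(T)$. Assume that for every object $X$ there is an initial $F(-)+X$-algebra $i_X:F(F^*X)+X\to F^*X$, and let $(F^*,m,e)$ be the associated free monad over $F$ (defined in the context). Let $\overline{F}^*$ be the endofunctor of $\mathcal{K}l(T)$ defined by $\overline{F}^*X=F^*X$ and, for $g:X\rightsquigarrow Y$, $\overline{F}^*g$ the unique $h:F^*X\rightsquigarrow F^*Y$ with $h\cdot i_X^\sharp=i_Y^\sharp\cdot(\overline{F}h+g)$. Then (i) $F^*$ lifts to $\overline{F}^*$, i.e. $\overline{F}^*(f^\sharp)=(F^*f)^\sharp$ for every morphism $f$ of $\mathsf{C}$; and (ii) $(\overline{F}^*,m^\sharp,e^\sharp)$ is a monad on $\mathcal{K}l(T)$ which is a free monad over $\overline{F}$.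
   Context: Kleisli category $\mathcal{K}l(T)$: objects of $\mathsf{C}$, morphisms $f:X\rightsquigarrow Y$ are morphisms $X\to TY$ of $\mathsf{C}$, composition $g\cdot f=\mu_Z\circ Tg\circ f$, identity $\eta_X$; for $f:X\to Y$ in $\mathsf{C}$, $f^\sharp=\eta_Y\circ f$, and for a natural transformation $\theta$ of $\mathsf{C}$, $\theta^\sharp$ has components $\theta_X^\sharp$. $F$ lifts to $\overline{F}$ means $\overline{F}X=FX$ and $\overline{F}(f^\sharp)=(Ff)^\sharp$ (equivalently $\overline{F}g=\lambda_Y\circ Fg$ for a distributive law $\lambda:FT\Rightarrow TF$). Coproducts in $\mathcal{K}l(T)$ are those of $\mathsf{C}$ with coprojections $\mathsf{inl}^\sharp,\mathsf{inr}^\sharp$. The free monad $(F^*,m,e)$: $F^*X$ is the carrier of $i_X$; for $f:X\to Y$, $F^*f$ is the unique morphism with $F^*f\circ i_X=i_Y\circ(F(F^*f)+f)$; $m_X:F^*F^*X\to F^*X$ is the unique morphism with $m_X\circ i_{F^*X}=[i_X\circ\mathsf{inl},id]\circ(F(m_X)+id)$; $e_X=i_X\circ\mathsf{inr}$. It is known that each $i_X^\sharp=\eta\circ i_X$ is an initial $\overline{F}(-)+X$-algebra in $\mathcal{K}l(T)$, so $\overline{F}^*$ is well defined. *)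

theory Defs
  imports Main
begin

text \<open>
  Categories are given by hom-set families that need not be pairwise disjoint; composition and the
  morphism part of functors therefore carry the objects involved as explicit arguments.  In this
  way a Kleisli morphism \<open>X \<leadsto> Y\<close> literally is a morphism \<open>X \<rightarrow> T Y\<close>.
  \<open>cmp C X Y Z g f\<close> is the composite of \<open>f : X \<rightarrow> Y\<close> followed by \<open>g : Y \<rightarrow> Z\<close>.
  All operations are only specified on the objects and morphisms of the category.
\<close>

record ('o, 'm) cat =
  Ob  :: "'o set"
  Hom :: "'o \<Rightarrow> 'o \<Rightarrow> 'm set"
  ide :: "'o \<Rightarrow> 'm"
  cmp :: "'o \<Rightarrow> 'o \<Rightarrow> 'o \<Rightarrow> 'm \<Rightarrow> 'm \<Rightarrow> 'm"

locale category =
  fixes C :: "('o, 'm) cat"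
  assumes ide_hom: "X \<in> Ob C \<Longrightarrow> ide C X \<in> Hom C X X"
    and cmp_hom: "\<lbrakk>X \<in> Ob C; Y \<in> Ob C; Z \<in> Ob C; f \<in> Hom C X Y; g \<in> Hom C Y Z\<rbrakk>
      \<Longrightarrow> cmp C X Y Z g f \<in> Hom C X Z"
    and cmp_ide_left: "\<lbrakk>X \<in> Ob C; Y \<in> Ob C; f \<in> Hom C X Y\<rbrakk> \<Longrightarrow> cmp C X Y Y (ide C Y) f = f"
    and cmp_ide_right: "\<lbrakk>X \<in> Ob C; Y \<in> Ob C; f \<in> Hom C X Y\<rbrakk> \<Longrightarrow> cmp C X X Y f (ide C X) = f"
    and cmp_assoc: "\<lbrakk>W \<in> Ob C; X \<in> Ob C; Y \<in> Ob C; Z \<in> Ob C;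
        f \<in> Hom C W X; g \<in> Hom C X Y; h \<in> Hom C Y Z\<rbrakk>
      \<Longrightarrow> cmp C W Y Z h (cmp C W X Y g f) = cmp C W X Z (cmp C X Y Z h g) f"

record ('o, 'm) endo =
  omap :: "'o \<Rightarrow> 'o"
  amap :: "'o \<Rightarrow> 'o \<Rightarrow> 'm \<Rightarrow> 'm"

definition endofunctor :: "('o, 'm) cat \<Rightarrow> ('o, 'm, 'z) endo_scheme \<Rightarrow> bool" where
  "endofunctor C F \<longleftrightarrow>
     (\<forall>X\<in>Ob C. omap F X \<in> Ob C) \<and>
     (\<forall>X\<in>Ob C. \<forall>Y\<in>Ob C. \<forall>f\<in>Hom C X Y. amap F X Y f \<in> Hom C (omap F X) (omap F Y)) \<and>
     (\<forall>X\<in>Ob C. amap F X X (ide C X) = ide C (omap F X)) \<and>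
     (\<forall>X\<in>Ob C. \<forall>Y\<in>Ob C. \<forall>Z\<in>Ob C. \<forall>f\<in>Hom C X Y. \<forall>g\<in>Hom C Y Z.
        amap F X Z (cmp C X Y Z g f) =
          cmp C (omap F X) (omap F Y) (omap F Z) (amap F Y Z g) (amap F X Y f))"

definition id_endo :: "('o, 'm) endo" where
  "id_endo = \<lparr>omap = (\<lambda>X. X), amap = (\<lambda>X Y f. f)\<rparr>"

definition comp_endo ::
    "('o, 'm, 'z) endo_scheme \<Rightarrow> ('o, 'm, 'y) endo_scheme \<Rightarrow> ('o, 'm) endo" where
  "comp_endo G F = \<lparr>omap = (\<lambda>X. omap G (omap F X)),
     amap = (\<lambda>X Y f. amap G (omap F X) (omap F Y) (amap F X Y f))\<rparr>"

definition nat_trans ::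
    "('o, 'm) cat \<Rightarrow> ('o, 'm, 'z) endo_scheme \<Rightarrow> ('o, 'm, 'y) endo_scheme \<Rightarrow> ('o \<Rightarrow> 'm) \<Rightarrow> bool" where
  "nat_trans C F G \<theta> \<longleftrightarrow>
     (\<forall>X\<in>Ob C. \<theta> X \<in> Hom C (omap F X) (omap G X)) \<and>
     (\<forall>X\<in>Ob C. \<forall>Y\<in>Ob C. \<forall>f\<in>Hom C X Y.
        cmp C (omap F X) (omap F Y) (omap G Y) (\<theta> Y) (amap F X Y f) =
        cmp C (omap F X) (omap G X) (omap G Y) (amap G X Y f) (\<theta> X))"

record ('o, 'm) monad_data = "('o, 'm) endo" +
  mu  :: "'o \<Rightarrow> 'm"
  eta :: "'o \<Rightarrow> 'm"

definition monad :: "('o, 'm) cat \<Rightarrow> ('o, 'm) monad_data \<Rightarrow> bool" where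
  "monad C M \<longleftrightarrow>
     endofunctor C M \<and>
     nat_trans C (comp_endo M M) M (mu M) \<and>
     nat_trans C id_endo M (eta M) \<and>
     (\<forall>X\<in>Ob C. let MX = omap M X; MMX = omap M MX; MMMX = omap M MMX in
        cmp C MMMX MMX MX (mu M X) (amap M MMX MX (mu M X)) =
          cmp C MMMX MMX MX (mu M X) (mu M MX) \<and>
        cmp C MX MMX MX (mu M X) (amap M X MX (eta M X)) = ide C MX \<and>
        cmp C MX MMX MX (mu M X) (eta M MX) = ide C MX)"

definition monad_morphism ::
    "('o, 'm) cat \<Rightarrow> ('o, 'm) monad_data \<Rightarrow> ('o, 'm) monad_data \<Rightarrow> ('o \<Rightarrow> 'm) \<Rightarrow> bool" where
  "monad_morphism C M N h \<longleftrightarrow>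
     nat_trans C M N h \<and>
     (\<forall>X\<in>Ob C. let MX = omap M X; NX = omap N X; MMX = omap M MX; NNX = omap N NX in
        cmp C X MX NX (h X) (eta M X) = eta N X \<and>
        cmp C MMX MX NX (h X) (mu M X) =
          cmp C MMX NNX NX (mu N X)
            (cmp C MMX (omap N MX) NNX (amap N MX NX (h X)) (h MX)))"

text \<open>
  Freeness is the usual universal property.  Monad morphisms are functions on the whole object
  type, so uniqueness is required on the objects of the category only.
\<close>

definition free_monad_over ::
    "('o, 'm) cat \<Rightarrow> ('o, 'm, 'z) endo_scheme \<Rightarrow> ('o, 'm) monad_data \<Rightarrow> bool" where
  "free_monad_over C F M \<longleftrightarrow>
     monad C M \<and>
     (\<exists>\<nu>. nat_trans C F M \<nu> \<and>
       (\<forall>N s. monad C N \<and> nat_trans C F N s \<longrightarrow>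
         (let extends = (\<lambda>h. monad_morphism C M N h \<and>
                (\<forall>X\<in>Ob C. cmp C (omap F X) (omap M X) (omap N X) (h X) (\<nu> X) = s X))
          in \<exists>h. extends h \<and> (\<forall>h'. extends h' \<longrightarrow> (\<forall>X\<in>Ob C. h' X = h X)))))"

record ('o, 'm) coprod =
  csum :: "'o \<Rightarrow> 'o \<Rightarrow> 'o"
  inl  :: "'o \<Rightarrow> 'o \<Rightarrow> 'm"
  inr  :: "'o \<Rightarrow> 'o \<Rightarrow> 'm"

definition is_copair ::
    "('o, 'm) cat \<Rightarrow> ('o, 'm) coprod \<Rightarrow> 'o \<Rightarrow> 'o \<Rightarrow> 'o \<Rightarrow> 'm \<Rightarrow> 'm \<Rightarrow> 'm \<Rightarrow> bool" where
  "is_copair C P X Y Z f g h \<longleftrightarrow>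
     h \<in> Hom C (csum P X Y) Z \<and>
     cmp C X (csum P X Y) Z h (inl P X Y) = f \<and>
     cmp C Y (csum P X Y) Z h (inr P X Y) = g"

definition binary_coproducts :: "('o, 'm) cat \<Rightarrow> ('o, 'm) coprod \<Rightarrow> bool" where
  "binary_coproducts C P \<longleftrightarrow>
     (\<forall>X\<in>Ob C. \<forall>Y\<in>Ob C.
        csum P X Y \<in> Ob C \<and>
        inl P X Y \<in> Hom C X (csum P X Y) \<and>
        inr P X Y \<in> Hom C Y (csum P X Y) \<and>
        (\<forall>Z\<in>Ob C. \<forall>f\<in>Hom C X Z. \<forall>g\<in>Hom C Y Z. \<exists>!h. is_copair C P X Y Z f g h))"

definition copair ::
    "('o, 'm) cat \<Rightarrow> ('o, 'm) coprod \<Rightarrow> 'o \<Rightarrow> 'o \<Rightarrow> 'o \<Rightarrow> 'm \<Rightarrow> 'm \<Rightarrow> 'm" where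
  "copair C P X Y Z f g = (THE h. is_copair C P X Y Z f g h)"

text \<open>\<open>csum_map C P X Y X' Y' f g\<close> is \<open>f + g : X + Y \<rightarrow> X' + Y'\<close>.\<close>

definition csum_map ::
    "('o, 'm) cat \<Rightarrow> ('o, 'm) coprod \<Rightarrow> 'o \<Rightarrow> 'o \<Rightarrow> 'o \<Rightarrow> 'o \<Rightarrow> 'm \<Rightarrow> 'm \<Rightarrow> 'm" where
  "csum_map C P X Y X' Y' f g =
     copair C P X Y (csum P X' Y')
       (cmp C X X' (csum P X' Y') (inl P X' Y') f)
       (cmp C Y Y' (csum P X' Y') (inr P X' Y') g)"

definition algebra :: "('o, 'm) cat \<Rightarrow> ('o, 'm) endo \<Rightarrow> 'o \<Rightarrow> 'm \<Rightarrow> bool" where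
  "algebra C G A a \<longleftrightarrow> A \<in> Ob C \<and> a \<in> Hom C (omap G A) A"

definition algebra_hom ::
    "('o, 'm) cat \<Rightarrow> ('o, 'm) endo \<Rightarrow> 'o \<Rightarrow> 'm \<Rightarrow> 'o \<Rightarrow> 'm \<Rightarrow> 'm \<Rightarrow> bool" where
  "algebra_hom C G A a B b h \<longleftrightarrow>
     h \<in> Hom C A B \<and>
     cmp C (omap G A) A B h a = cmp C (omap G A) (omap G B) B b (amap G A B h)"

definition initial_algebra :: "('o, 'm) cat \<Rightarrow> ('o, 'm) endo \<Rightarrow> 'o \<Rightarrow> 'm \<Rightarrow> bool" where
  "initial_algebra C G A a \<longleftrightarrow>
     algebra C G A a \<and> (\<forall>B b. algebra C G B b \<longrightarrow> (\<exists>!h. algebra_hom C G A a B b h))"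

text \<open>The endofunctor \<open>F(-) + X\<close>.\<close>

definition plus_const ::
    "('o, 'm) cat \<Rightarrow> ('o, 'm) coprod \<Rightarrow> ('o, 'm) endo \<Rightarrow> 'o \<Rightarrow> ('o, 'm) endo" where
  "plus_const C P F X =
     \<lparr>omap = (\<lambda>A. csum P (omap F A) X),
      amap = (\<lambda>A B f. csum_map C P (omap F A) X (omap F B) X (amap F A B f) (ide C X))\<rparr>"

text \<open>
  In the following three definitions \<open>S X\<close> is the carrier and \<open>i X : F (S X) + X \<rightarrow> S X\<close> the
  structure map of an initial \<open>F(-) + X\<close>-algebra.
\<close>

definition star_endo ::
    "('o, 'm) cat \<Rightarrow> ('o, 'm) coprod \<Rightarrow> ('o, 'm) endo \<Rightarrow> ('o \<Rightarrow> 'o) \<Rightarrow> ('o \<Rightarrow> 'm) \<Rightarrow> ('o, 'm) endo" where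
  "star_endo C P F S i =
     \<lparr>omap = S,
      amap = (\<lambda>X Y f. THE h.
        h \<in> Hom C (S X) (S Y) \<and>
        cmp C (csum P (omap F (S X)) X) (S X) (S Y) h (i X) =
        cmp C (csum P (omap F (S X)) X) (csum P (omap F (S Y)) Y) (S Y) (i Y)
          (csum_map C P (omap F (S X)) X (omap F (S Y)) Y (amap F (S X) (S Y) h) f))\<rparr>"

definition star_mult ::
    "('o, 'm) cat \<Rightarrow> ('o, 'm) coprod \<Rightarrow> ('o, 'm) endo \<Rightarrow> ('o \<Rightarrow> 'o) \<Rightarrow> ('o \<Rightarrow> 'm) \<Rightarrow> 'o \<Rightarrow> 'm" where
  "star_mult C P F S i X =
     (let FSX = omap F (S X); FSSX = omap F (S (S X)) in
      THE h.
        h \<in> Hom C (S (S X)) (S X) \<and>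
        cmp C (csum P FSSX (S X)) (S (S X)) (S X) h (i (S X)) =
        cmp C (csum P FSSX (S X)) (csum P FSX (S X)) (S X)
          (copair C P FSX (S X) (S X)
             (cmp C FSX (csum P FSX X) (S X) (i X) (inl P FSX X)) (ide C (S X)))
          (csum_map C P FSSX (S X) FSX (S X) (amap F (S (S X)) (S X) h) (ide C (S X))))"

definition star_unit ::
    "('o, 'm) cat \<Rightarrow> ('o, 'm) coprod \<Rightarrow> ('o, 'm) endo \<Rightarrow> ('o \<Rightarrow> 'o) \<Rightarrow> ('o \<Rightarrow> 'm) \<Rightarrow> 'o \<Rightarrow> 'm" where
  "star_unit C P F S i X =
     cmp C X (csum P (omap F (S X)) X) (S X) (i X) (inr P (omap F (S X)) X)"

definition kleisli :: "('o, 'm) cat \<Rightarrow> ('o, 'm) monad_data \<Rightarrow> ('o, 'm) cat" where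
  "kleisli C T =
     \<lparr>Ob = Ob C,
      Hom = (\<lambda>X Y. Hom C X (omap T Y)),
      ide = eta T,
      cmp = (\<lambda>X Y Z g f.
        cmp C X (omap T (omap T Z)) (omap T Z) (mu T Z)
          (cmp C X (omap T Y) (omap T (omap T Z)) (amap T Y (omap T Z) g) f))\<rparr>"

text \<open>\<open>sharp C T X Y f\<close> is \<open>f\<^sup>\<sharp> = \<eta>\<^sub>Y \<circ> f\<close> for \<open>f : X \<rightarrow> Y\<close>.\<close>

definition sharp :: "('o, 'm) cat \<Rightarrow> ('o, 'm) monad_data \<Rightarrow> 'o \<Rightarrow> 'o \<Rightarrow> 'm \<Rightarrow> 'm" where
  "sharp C T X Y f = cmp C X Y (omap T Y) (eta T Y) f"

definition kleisli_coprod ::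
    "('o, 'm) cat \<Rightarrow> ('o, 'm) monad_data \<Rightarrow> ('o, 'm) coprod \<Rightarrow> ('o, 'm) coprod" where
  "kleisli_coprod C T P =
     \<lparr>csum = csum P,
      inl = (\<lambda>X Y. sharp C T X (csum P X Y) (inl P X Y)),
      inr = (\<lambda>X Y. sharp C T Y (csum P X Y) (inr P X Y))\<rparr>"

definition lifts_to ::
    "('o, 'm) cat \<Rightarrow> ('o, 'm) monad_data \<Rightarrow> ('o, 'm) endo \<Rightarrow> ('o, 'm) endo \<Rightarrow> bool" where
  "lifts_to C T F G \<longleftrightarrow>
     endofunctor (kleisli C T) G \<and>
     (\<forall>X\<in>Ob C. omap G X = omap F X) \<and>
     (\<forall>X\<in>Ob C. \<forall>Y\<in>Ob C. \<forall>f\<in>Hom C X Y.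
        amap G X Y (sharp C T X Y f) = sharp C T (omap F X) (omap F Y) (amap F X Y f))"

text \<open>
  The endofunctor on the Kleisli category obtained from a lifting \<open>G\<close> of \<open>F\<close> and the algebras
  \<open>(i X)\<^sup>\<sharp>\<close>, which are initial \<open>G(-) + X\<close>-algebras in the Kleisli category.
\<close>

definition kleisli_star ::
    "('o, 'm) cat \<Rightarrow> ('o, 'm) coprod \<Rightarrow> ('o, 'm) monad_data \<Rightarrow> ('o, 'm) endo \<Rightarrow> ('o, 'm) endo
      \<Rightarrow> ('o \<Rightarrow> 'o) \<Rightarrow> ('o \<Rightarrow> 'm) \<Rightarrow> ('o, 'm) endo" where
  "kleisli_star C P T F G S i =
     star_endo (kleisli C T) (kleisli_coprod C T P) G S
       (\<lambda>X. sharp C T (csum P (omap F (S X)) X) (S X) (i X))"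

text \<open>The lifted endofunctor with the components of \<open>m\<^sup>\<sharp>\<close> and \<open>e\<^sup>\<sharp>\<close> as multiplication and unit.\<close>

definition kleisli_star_monad ::
    "('o, 'm) cat \<Rightarrow> ('o, 'm) coprod \<Rightarrow> ('o, 'm) monad_data \<Rightarrow> ('o, 'm) endo \<Rightarrow> ('o, 'm) endo
      \<Rightarrow> ('o \<Rightarrow> 'o) \<Rightarrow> ('o \<Rightarrow> 'm) \<Rightarrow> ('o, 'm) monad_data" where
  "kleisli_star_monad C P T F G S i =
     \<lparr>omap = omap (kleisli_star C P T F G S i),
      amap = amap (kleisli_star C P T F G S i),
      mu = (\<lambda>X. sharp C T (S (S X)) (S X) (star_mult C P F S i X)),
      eta = (\<lambda>X. sharp C T X (S X) (star_unit C P F S i X))\<rparr>"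

end

theory Submission
  imports Defs
begin

text \<open>
  Splitting the structure map of an initial \<open>F(-) + X\<close>-algebra along the coprojections exhibits its
  carrier as a free \<open>F\<close>-algebra on \<open>X\<close>. In any category, free algebras on all objects form a free
  monad: every equation is an equality of algebra homomorphisms out of a free algebra that agree on
  the generators. Freeness passes from \<open>F\<close> to its lifting because a Kleisli algebra on \<open>B\<close> is an
  \<open>F\<close>-algebra on \<open>T B\<close> with the same homomorphisms from algebras of the form \<open>a\<^sup>\<sharp>\<close>; and
  \<open>(F\<^sup>* f)\<^sup>\<sharp>\<close> and \<open>m\<^sup>\<sharp>\<close> are homomorphisms of the lifted free algebras, so uniqueness identifies
  them with the corresponding Kleisli data.
\<close>

section \<open>Projections from the definitions of functor, natural transformation and monad\<close>

lemma functor_ob: "endofunctor C F \<Longrightarrow> X \<in> Ob C \<Longrightarrow> omap F X \<in> Ob C"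
  by (simp add: endofunctor_def)

lemma functor_hom:
  "\<lbrakk>endofunctor C F; X \<in> Ob C; Y \<in> Ob C; f \<in> Hom C X Y\<rbrakk>
    \<Longrightarrow> amap F X Y f \<in> Hom C (omap F X) (omap F Y)"
  by (simp add: endofunctor_def)

lemma functor_ide: "endofunctor C F \<Longrightarrow> X \<in> Ob C \<Longrightarrow> amap F X X (ide C X) = ide C (omap F X)"
  by (simp add: endofunctor_def)

lemma functor_cmp:
  "\<lbrakk>endofunctor C F; X \<in> Ob C; Y \<in> Ob C; Z \<in> Ob C; f \<in> Hom C X Y; g \<in> Hom C Y Z\<rbrakk>
    \<Longrightarrow> amap F X Z (cmp C X Y Z g f) =
      cmp C (omap F X) (omap F Y) (omap F Z) (amap F Y Z g) (amap F X Y f)"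
  by (simp add: endofunctor_def)

lemma nat_trans_hom: "nat_trans C F G \<theta> \<Longrightarrow> X \<in> Ob C \<Longrightarrow> \<theta> X \<in> Hom C (omap F X) (omap G X)"
  by (simp add: nat_trans_def)

lemma nat_trans_square:
  "\<lbrakk>nat_trans C F G \<theta>; X \<in> Ob C; Y \<in> Ob C; f \<in> Hom C X Y\<rbrakk>
    \<Longrightarrow> cmp C (omap F X) (omap F Y) (omap G Y) (\<theta> Y) (amap F X Y f) =
      cmp C (omap F X) (omap G X) (omap G Y) (amap G X Y f) (\<theta> X)"
  by (simp add: nat_trans_def)

lemma monad_functor: "monad C M \<Longrightarrow> endofunctor C M"
  by (simp add: monad_def)

lemma mu_hom:
  "monad C M \<Longrightarrow> X \<in> Ob C \<Longrightarrow> mu M X \<in> Hom C (omap M (omap M X)) (omap M X)"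
  by (simp add: monad_def nat_trans_def comp_endo_def)

lemma eta_hom: "monad C M \<Longrightarrow> X \<in> Ob C \<Longrightarrow> eta M X \<in> Hom C X (omap M X)"
  by (simp add: monad_def nat_trans_def id_endo_def)

lemma mu_natural:
  "\<lbrakk>monad C M; X \<in> Ob C; Y \<in> Ob C; f \<in> Hom C X Y\<rbrakk>
    \<Longrightarrow> cmp C (omap M (omap M X)) (omap M (omap M Y)) (omap M Y) (mu M Y)
          (amap M (omap M X) (omap M Y) (amap M X Y f)) =
        cmp C (omap M (omap M X)) (omap M X) (omap M Y) (amap M X Y f) (mu M X)"
  by (simp add: monad_def nat_trans_def comp_endo_def)

lemma eta_natural:
  "\<lbrakk>monad C M; X \<in> Ob C; Y \<in> Ob C; f \<in> Hom C X Y\<rbrakk>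
    \<Longrightarrow> cmp C X Y (omap M Y) (eta M Y) f = cmp C X (omap M X) (omap M Y) (amap M X Y f) (eta M X)"
  by (simp add: monad_def nat_trans_def id_endo_def)

lemma mu_assoc:
  "monad C M \<Longrightarrow> X \<in> Ob C \<Longrightarrow>
    cmp C (omap M (omap M (omap M X))) (omap M (omap M X)) (omap M X) (mu M X)
      (amap M (omap M (omap M X)) (omap M X) (mu M X)) =
    cmp C (omap M (omap M (omap M X))) (omap M (omap M X)) (omap M X) (mu M X) (mu M (omap M X))"
  by (simp add: monad_def Let_def)

lemma mu_map_eta:
  "monad C M \<Longrightarrow> X \<in> Ob C \<Longrightarrow>
    cmp C (omap M X) (omap M (omap M X)) (omap M X) (mu M X) (amap M X (omap M X) (eta M X)) =
    ide C (omap M X)"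
  by (simp add: monad_def Let_def)

lemma mu_eta:
  "monad C M \<Longrightarrow> X \<in> Ob C \<Longrightarrow>
    cmp C (omap M X) (omap M (omap M X)) (omap M X) (mu M X) (eta M (omap M X)) = ide C (omap M X)"
  by (simp add: monad_def Let_def)

lemmas functor_rules = functor_ob functor_hom functor_ide functor_cmp
lemmas monad_rules = functor_rules[OF monad_functor] mu_hom eta_hom

text \<open>In a composite bracketed to the right, the arrows \<open>f\<close> and \<open>g\<close>
  do not form a subterm, so a commuting square cannot be rewritten in place. This rule precomposes
  both legs with \<open>k\<close> and leaves only typing conditions.\<close>

lemma (in category) cmp_eq_cmp:
  assumes "cmp C X Y Z g f = cmp C X Y' Z g' f'"
    and "W \<in> Ob C" "X \<in> Ob C" "Y \<in> Ob C" "Y' \<in> Ob C" "Z \<in> Ob C"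
    and "k \<in> Hom C W X" "f \<in> Hom C X Y" "g \<in> Hom C Y Z" "f' \<in> Hom C X Y'" "g' \<in> Hom C Y' Z"
  shows "cmp C W Y Z g (cmp C W X Y f k) = cmp C W Y' Z g' (cmp C W X Y' f' k)"
  using assms by (simp add: cmp_assoc)

section \<open>Free algebras of an endofunctor\<close>

text \<open>A universal arrow from \<open>X\<close> to the forgetful functor on
  \<open>G\<close>-algebras. Unlike initiality for \<open>F(-) + X\<close>, it mentions no
  coproduct, so it can be compared directly between \<open>C\<close> and its Kleisli
  category.\<close>

definition free_algebra ::
    "('o, 'm) cat \<Rightarrow> ('o, 'm) endo \<Rightarrow> 'o \<Rightarrow> 'o \<Rightarrow> 'm \<Rightarrow> 'm \<Rightarrow> bool" where
  "free_algebra C G X A a e \<longleftrightarrow>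
     algebra C G A a \<and> e \<in> Hom C X A \<and>
     (\<forall>B b f. algebra C G B b \<and> f \<in> Hom C X B \<longrightarrow>
        (\<exists>!h. algebra_hom C G A a B b h \<and> cmp C X A B h e = f))"

lemma free_algebra_ex1:
  "\<lbrakk>free_algebra C G X A a e; algebra C G B b; f \<in> Hom C X B\<rbrakk>
    \<Longrightarrow> \<exists>!h. algebra_hom C G A a B b h \<and> cmp C X A B h e = f"
  by (simp add: free_algebra_def)

context category
begin

text \<open>Uniqueness in the universal property, applied to the common restriction along
  \<open>e\<close>. The equations between homomorphisms below are reduced by this rule to a
  computation on generators.\<close>

lemma free_algebra_hom_eq:
  assumes "free_algebra C G X A a e" "algebra C G B b" "X \<in> Ob C"
    and "algebra_hom C G A a B b h" "algebra_hom C G A a B b k"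
    and "cmp C X A B h e = cmp C X A B k e"
  shows "h = k"
proof -
  have "cmp C X A B h e \<in> Hom C X B"
    using assms by (auto simp: free_algebra_def algebra_def algebra_hom_def intro!: cmp_hom)
  with free_algebra_ex1[OF assms(1,2)] assms show ?thesis by metis
qed

lemma algebra_hom_ide:
  assumes "endofunctor C G" "algebra C G A a"
  shows "algebra_hom C G A a A a (ide C A)"
  using assms
  by (simp add: algebra_def algebra_hom_def functor_rules ide_hom cmp_ide_left cmp_ide_right)

lemma algebra_hom_cmp:
  assumes G: "endofunctor C G" and A: "algebra C G A a" and B: "algebra C G B b"
    and D: "algebra C G D d"
    and h: "algebra_hom C G A a B b h" and k: "algebra_hom C G B b D d k"
  shows "algebra_hom C G A a D d (cmp C A B D k h)"
proof -
  note facts = assms[unfolded algebra_def algebra_hom_def] functor_rules[OF G]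
  have "cmp C (omap G A) A D (cmp C A B D k h) a = cmp C (omap G A) B D k (cmp C (omap G A) A B h a)"
    using facts by (simp add: cmp_assoc[symmetric])
  also have "\<dots> = cmp C (omap G A) B D k (cmp C (omap G A) (omap G B) B b (amap G A B h))"
    using facts by simp
  also have "\<dots> = cmp C (omap G A) (omap G D) D d
      (cmp C (omap G A) (omap G B) (omap G D) (amap G B D k) (amap G A B h))"
    using facts by (intro cmp_eq_cmp) simp_all
  finally show ?thesis
    using facts by (simp add: algebra_hom_def cmp_hom)
qed

end

section \<open>The monad of free algebras and its freeness\<close>

text \<open>The operations are characterised rather than defined: \<open>amap M X Y f\<close> is the
  homomorphism extending \<open>eta M Y\<close> after \<open>f\<close>, and \<open>mu M X\<close>
  the one extending the identity. The locale can therefore be interpreted with operations given by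
  other formulas, such as the components of m^sharp.\<close>

locale free_algebra_monad = category C for C :: "('o, 'm) cat" +
  fixes G :: "('o, 'm) endo" and M :: "('o, 'm) monad_data" and a :: "'o \<Rightarrow> 'm"
  assumes endo_G: "endofunctor C G"
    and free: "X \<in> Ob C \<Longrightarrow> free_algebra C G X (omap M X) (a X) (eta M X)"
    and map_algebra_hom: "\<lbrakk>X \<in> Ob C; Y \<in> Ob C; f \<in> Hom C X Y\<rbrakk>
      \<Longrightarrow> algebra_hom C G (omap M X) (a X) (omap M Y) (a Y) (amap M X Y f)"
    and map_eta: "\<lbrakk>X \<in> Ob C; Y \<in> Ob C; f \<in> Hom C X Y\<rbrakk>
      \<Longrightarrow> cmp C X (omap M X) (omap M Y) (amap M X Y f) (eta M X) =
        cmp C X Y (omap M Y) (eta M Y) f"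
    and mu_algebra_hom: "X \<in> Ob C
      \<Longrightarrow> algebra_hom C G (omap M (omap M X)) (a (omap M X)) (omap M X) (a X) (mu M X)"
    and mult_eta: "X \<in> Ob C
      \<Longrightarrow> cmp C (omap M X) (omap M (omap M X)) (omap M X) (mu M X) (eta M (omap M X)) =
        ide C (omap M X)"
begin

lemma free_ob: "X \<in> Ob C \<Longrightarrow> omap M X \<in> Ob C"
  using free by (auto simp: free_algebra_def algebra_def)

lemma free_alg: "X \<in> Ob C \<Longrightarrow> algebra C G (omap M X) (a X)"
  using free by (auto simp: free_algebra_def)

lemma str_hom: "X \<in> Ob C \<Longrightarrow> a X \<in> Hom C (omap G (omap M X)) (omap M X)"
  using free_alg by (auto simp: algebra_def)

lemma unit_hom: "X \<in> Ob C \<Longrightarrow> eta M X \<in> Hom C X (omap M X)"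
  using free by (auto simp: free_algebra_def)

lemma map_hom: "\<lbrakk>X \<in> Ob C; Y \<in> Ob C; f \<in> Hom C X Y\<rbrakk> \<Longrightarrow> amap M X Y f \<in> Hom C (omap M X) (omap M Y)"
  using map_algebra_hom by (auto simp: algebra_hom_def)

lemma mult_hom: "X \<in> Ob C \<Longrightarrow> mu M X \<in> Hom C (omap M (omap M X)) (omap M X)"
  using mu_algebra_hom by (auto simp: algebra_hom_def)

lemmas homs = free_ob free_alg str_hom unit_hom map_hom mult_hom cmp_hom ide_hom
  functor_rules[OF endo_G] cmp_ide_left cmp_ide_right

lemmas alg_homs = map_algebra_hom mu_algebra_hom algebra_hom_ide[OF endo_G]
  algebra_hom_cmp[OF endo_G]

lemma free_functor: "endofunctor C M"
  unfolding endofunctor_def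
proof (intro conjI ballI)
  fix X assume X: "X \<in> Ob C"
  show "amap M X X (ide C X) = ide C (omap M X)"
    by (rule free_algebra_hom_eq[OF free[OF X] free_alg[OF X]]) (use X in \<open>simp_all add: homs alg_homs map_eta\<close>)
next
  fix X Y Z f g
  assume X: "X \<in> Ob C" and Y: "Y \<in> Ob C" and Z: "Z \<in> Ob C"
    and f: "f \<in> Hom C X Y" and g: "g \<in> Hom C Y Z"
  show "amap M X Z (cmp C X Y Z g f) =
      cmp C (omap M X) (omap M Y) (omap M Z) (amap M Y Z g) (amap M X Y f)"
  proof (rule free_algebra_hom_eq[OF free free_alg])
    show "algebra_hom C G (omap M X) (a X) (omap M Z) (a Z)
        (cmp C (omap M X) (omap M Y) (omap M Z) (amap M Y Z g) (amap M X Y f))"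
      by (rule algebra_hom_cmp[OF endo_G free_alg free_alg free_alg])
        (use X Y Z f g in \<open>simp_all add: alg_homs\<close>)
    \<comment> \<open>By \<open>map_eta\<close>, used once for \<open>f\<close> and once for
      \<open>g\<close>, the composite restricts on generators to \<open>eta M Z\<close> after
      \<open>g\<close> after \<open>f\<close>.\<close>
    have "cmp C X (omap M X) (omap M Z)
        (cmp C (omap M X) (omap M Y) (omap M Z) (amap M Y Z g) (amap M X Y f)) (eta M X) =
      cmp C X (omap M Y) (omap M Z) (amap M Y Z g) (cmp C X Y (omap M Y) (eta M Y) f)"
      using X Y Z f g by (simp add: homs map_eta cmp_assoc[symmetric])
    also have "\<dots> = cmp C X Z (omap M Z) (eta M Z) (cmp C X Y Z g f)"
      by (rule cmp_eq_cmp) (use X Y Z f g in \<open>simp_all add: homs map_eta\<close>)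
    finally show "cmp C X (omap M X) (omap M Z) (amap M X Z (cmp C X Y Z g f)) (eta M X) =
      cmp C X (omap M X) (omap M Z)
        (cmp C (omap M X) (omap M Y) (omap M Z) (amap M Y Z g) (amap M X Y f)) (eta M X)"
      using X Y Z f g by (simp add: homs map_eta)
  qed (use X Y Z f g in \<open>simp_all add: homs alg_homs\<close>)
qed (simp_all add: homs)

text \<open>Both sides are homomorphisms out of the free algebra on \<open>omap M X\<close> and
  restrict to \<open>amap M X Y f\<close> on its generators.\<close>

lemma free_mu_natural:
  assumes X: "X \<in> Ob C" and Y: "Y \<in> Ob C" and f: "f \<in> Hom C X Y"
  shows "cmp C (omap M (omap M X)) (omap M (omap M Y)) (omap M Y) (mu M Y)
      (amap M (omap M X) (omap M Y) (amap M X Y f)) =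
    cmp C (omap M (omap M X)) (omap M X) (omap M Y) (amap M X Y f) (mu M X)"
proof (rule free_algebra_hom_eq[OF free free_alg])
  show "algebra_hom C G (omap M (omap M X)) (a (omap M X)) (omap M Y) (a Y)
     (cmp C (omap M (omap M X)) (omap M (omap M Y)) (omap M Y) (mu M Y)
       (amap M (omap M X) (omap M Y) (amap M X Y f)))"
    by (rule algebra_hom_cmp[OF endo_G free_alg free_alg free_alg])
      (use assms in \<open>simp_all add: homs alg_homs\<close>)
  show "algebra_hom C G (omap M (omap M X)) (a (omap M X)) (omap M Y) (a Y)
     (cmp C (omap M (omap M X)) (omap M X) (omap M Y) (amap M X Y f) (mu M X))"
    by (rule algebra_hom_cmp[OF endo_G free_alg free_alg free_alg])
      (use assms in \<open>simp_all add: homs alg_homs\<close>)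
  have "cmp C (omap M X) (omap M (omap M X)) (omap M Y)
     (cmp C (omap M (omap M X)) (omap M (omap M Y)) (omap M Y) (mu M Y)
       (amap M (omap M X) (omap M Y) (amap M X Y f))) (eta M (omap M X)) =
    cmp C (omap M X) (omap M (omap M Y)) (omap M Y) (mu M Y)
      (cmp C (omap M X) (omap M Y) (omap M (omap M Y)) (eta M (omap M Y)) (amap M X Y f))"
    using assms by (simp add: homs map_eta cmp_assoc[symmetric])
  also have "\<dots> = amap M X Y f"
    using assms by (simp add: homs mult_eta cmp_assoc)
  finally show "cmp C (omap M X) (omap M (omap M X)) (omap M Y)
     (cmp C (omap M (omap M X)) (omap M (omap M Y)) (omap M Y) (mu M Y)
       (amap M (omap M X) (omap M Y) (amap M X Y f))) (eta M (omap M X)) =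
    cmp C (omap M X) (omap M (omap M X)) (omap M Y)
     (cmp C (omap M (omap M X)) (omap M X) (omap M Y) (amap M X Y f) (mu M X)) (eta M (omap M X))"
    using assms by (simp add: homs mult_eta cmp_assoc[symmetric])
qed (use assms in \<open>simp_all add: homs\<close>)

text \<open>Both composites restrict to \<open>mu M X\<close> on the generators
  \<open>omap M (omap M X)\<close>.\<close>

lemma free_mu_assoc:
  assumes X: "X \<in> Ob C"
  shows "cmp C (omap M (omap M (omap M X))) (omap M (omap M X)) (omap M X) (mu M X)
      (amap M (omap M (omap M X)) (omap M X) (mu M X)) =
    cmp C (omap M (omap M (omap M X))) (omap M (omap M X)) (omap M X) (mu M X) (mu M (omap M X))"
    (is "?l = ?r")
proof (rule free_algebra_hom_eq[OF free free_alg])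
  show "algebra_hom C G (omap M (omap M (omap M X))) (a (omap M (omap M X))) (omap M X) (a X) ?l"
    by (rule algebra_hom_cmp[OF endo_G free_alg free_alg free_alg])
      (use assms in \<open>simp_all add: homs alg_homs\<close>)
  show "algebra_hom C G (omap M (omap M (omap M X))) (a (omap M (omap M X))) (omap M X) (a X) ?r"
    by (rule algebra_hom_cmp[OF endo_G free_alg free_alg free_alg])
      (use assms in \<open>simp_all add: homs alg_homs\<close>)
  have "cmp C (omap M (omap M X)) (omap M (omap M (omap M X))) (omap M X) ?l
      (eta M (omap M (omap M X))) =
    cmp C (omap M (omap M X)) (omap M (omap M X)) (omap M X) (mu M X)
      (cmp C (omap M (omap M X)) (omap M X) (omap M (omap M X)) (eta M (omap M X)) (mu M X))"
    using assms by (simp add: homs map_eta cmp_assoc[symmetric])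
  also have "\<dots> = mu M X"
    using assms by (simp add: homs mult_eta cmp_assoc)
  finally show "cmp C (omap M (omap M X)) (omap M (omap M (omap M X))) (omap M X) ?l
      (eta M (omap M (omap M X))) =
    cmp C (omap M (omap M X)) (omap M (omap M (omap M X))) (omap M X) ?r
      (eta M (omap M (omap M X)))"
    using assms by (simp add: homs mult_eta cmp_assoc[symmetric])
qed (use assms in \<open>simp_all add: homs\<close>)

text \<open>Both sides restrict to \<open>eta M X\<close> on the generators
  \<open>X\<close>.\<close>

lemma free_mu_map_eta:
  assumes X: "X \<in> Ob C"
  shows "cmp C (omap M X) (omap M (omap M X)) (omap M X) (mu M X)
      (amap M X (omap M X) (eta M X)) = ide C (omap M X)" (is "?l = _")
proof (rule free_algebra_hom_eq[OF free free_alg])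
  show "algebra_hom C G (omap M X) (a X) (omap M X) (a X) ?l"
    by (rule algebra_hom_cmp[OF endo_G free_alg free_alg free_alg])
      (use assms in \<open>simp_all add: homs alg_homs\<close>)
  have "cmp C X (omap M X) (omap M X) ?l (eta M X) =
    cmp C X (omap M (omap M X)) (omap M X) (mu M X)
      (cmp C X (omap M X) (omap M (omap M X)) (eta M (omap M X)) (eta M X))"
    using assms by (simp add: homs map_eta cmp_assoc[symmetric])
  also have "\<dots> = eta M X"
    using assms by (simp add: homs mult_eta cmp_assoc)
  finally show "cmp C X (omap M X) (omap M X) ?l (eta M X) =
      cmp C X (omap M X) (omap M X) (ide C (omap M X)) (eta M X)"
    using assms by (simp add: homs)
qed (use assms in \<open>simp_all add: homs alg_homs\<close>)

theorem is_monad: "monad C M"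
  unfolding monad_def nat_trans_def Let_def comp_endo_def id_endo_def
  by (auto simp: free_functor homs map_eta free_mu_natural free_mu_assoc free_mu_map_eta mult_eta)

text \<open>The structure maps \<open>a\<close> and the transformation \<open>\<nu>\<close>
  determine each other through the monad operations. For a competitor \<open>N\<close> with
  \<open>s\<close>, the composite of \<open>mu N\<close> after \<open>s\<close> makes each
  \<open>omap N X\<close> a \<open>G\<close>-algebra; the monad morphisms compatible with
  \<open>s\<close> then turn out to be the homomorphisms extending \<open>eta N X\<close>.\<close>

theorem is_free: "free_monad_over C G M"
proof -
  define \<nu> where "\<nu> X = cmp C (omap G X) (omap G (omap M X)) (omap M X) (a X)
      (amap G X (omap M X) (eta M X))" for X
  have \<nu>_hom: "\<nu> X \<in> Hom C (omap G X) (omap M X)" if "X \<in> Ob C" for X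
    using that by (simp add: \<nu>_def homs)
  have \<nu>: "nat_trans C G M \<nu>"
    unfolding nat_trans_def
  proof (intro conjI ballI)
    fix X Y f assume X: "X \<in> Ob C" and Y: "Y \<in> Ob C" and f: "f \<in> Hom C X Y"
    have "cmp C (omap G X) (omap G Y) (omap M Y) (\<nu> Y) (amap G X Y f) =
      cmp C (omap G X) (omap G (omap M Y)) (omap M Y) (a Y)
        (amap G X (omap M Y) (cmp C X Y (omap M Y) (eta M Y) f))"
      using X Y f by (simp add: \<nu>_def homs cmp_assoc)
    also have "\<dots> = cmp C (omap G X) (omap G (omap M Y)) (omap M Y) (a Y)
        (cmp C (omap G X) (omap G (omap M X)) (omap G (omap M Y))
           (amap G (omap M X) (omap M Y) (amap M X Y f)) (amap G X (omap M X) (eta M X)))"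
      using X Y f by (simp add: map_eta[symmetric] homs)
    also have "\<dots> = cmp C (omap G X) (omap M X) (omap M Y) (amap M X Y f) (\<nu> X)"
      unfolding \<nu>_def using X Y f map_algebra_hom[OF X Y f]
      by (intro cmp_eq_cmp) (simp_all add: homs algebra_hom_def)
    finally show "cmp C (omap G X) (omap G Y) (omap M Y) (\<nu> Y) (amap G X Y f) =
      cmp C (omap G X) (omap M X) (omap M Y) (amap M X Y f) (\<nu> X)" .
  qed (simp add: \<nu>_hom)
  \<comment> \<open>Since \<open>mu M X\<close> is a homomorphism and cancels the unit under
    \<open>G\<close>, the structure map is recovered from \<open>\<nu>\<close>. The uniqueness
    argument needs this to see that a compatible monad morphism respects \<open>a X\<close>.\<close>
  have str_eq: "a X = cmp C (omap G (omap M X)) (omap M (omap M X)) (omap M X) (mu M X) (\<nu> (omap M X))"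
    if X: "X \<in> Ob C" for X
  proof -
    have "cmp C (omap G (omap M X)) (omap M (omap M X)) (omap M X) (mu M X) (\<nu> (omap M X)) =
      cmp C (omap G (omap M X)) (omap G (omap M X)) (omap M X) (a X)
       (cmp C (omap G (omap M X)) (omap G (omap M (omap M X))) (omap G (omap M X))
         (amap G (omap M (omap M X)) (omap M X) (mu M X))
         (amap G (omap M X) (omap M (omap M X)) (eta M (omap M X))))"
      unfolding \<nu>_def using X mu_algebra_hom[OF X]
      by (intro cmp_eq_cmp) (simp_all add: homs algebra_hom_def)
    also have "\<dots> = a X"
      using X by (simp add: homs mult_eta functor_cmp[OF endo_G, symmetric] del: functor_cmp[OF endo_G])
    finally show ?thesis by simp
  qed
  have "\<exists>h. (monad_morphism C M N h \<and>
        (\<forall>X\<in>Ob C. cmp C (omap G X) (omap M X) (omap N X) (h X) (\<nu> X) = s X)) \<and>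
      (\<forall>h'. monad_morphism C M N h' \<and>
          (\<forall>X\<in>Ob C. cmp C (omap G X) (omap M X) (omap N X) (h' X) (\<nu> X) = s X) \<longrightarrow>
        (\<forall>X\<in>Ob C. h' X = h X))"
    if N: "monad C N" and s: "nat_trans C G N s" for N s
  proof -
    \<comment> \<open>The formula of \<open>str_eq\<close> with \<open>N\<close> and
      \<open>s\<close> in place of \<open>M\<close> and \<open>\<nu>\<close>.\<close>
    define c where "c X = cmp C (omap G (omap N X)) (omap N (omap N X)) (omap N X)
        (mu N X) (s (omap N X))" for X
    note Nh = monad_rules[OF N] nat_trans_hom[OF s]
    have c_alg: "algebra C G (omap N X) (c X)" if "X \<in> Ob C" for X
      using that by (simp add: algebra_def c_def homs Nh)
    \<comment> \<open>\<open>Nmap\<close> and \<open>Nmu\<close> make the composites in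
      \<open>h_nat\<close> and \<open>h_mu\<close> algebra homomorphisms, so that freeness applies.
      They rest on naturality and associativity of \<open>mu N\<close> respectively, each combined
      with naturality of \<open>s\<close>.\<close>
    have Nmap: "algebra_hom C G (omap N X) (c X) (omap N Y) (c Y) (amap N X Y f)"
      if X: "X \<in> Ob C" and Y: "Y \<in> Ob C" and f: "f \<in> Hom C X Y" for X Y f
    proof -
      have "cmp C (omap G (omap N X)) (omap N X) (omap N Y) (amap N X Y f) (c X) =
        cmp C (omap G (omap N X)) (omap N (omap N Y)) (omap N Y) (mu N Y)
          (cmp C (omap G (omap N X)) (omap N (omap N X)) (omap N (omap N Y))
            (amap N (omap N X) (omap N Y) (amap N X Y f)) (s (omap N X)))"
        unfolding c_def using X Y f mu_natural[OF N X Y f]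
        by (intro cmp_eq_cmp) (simp_all add: homs Nh)
      also have "\<dots> = cmp C (omap G (omap N X)) (omap G (omap N Y)) (omap N Y) (c Y)
          (amap G (omap N X) (omap N Y) (amap N X Y f))"
        using X Y f by (simp add: c_def homs Nh cmp_assoc[symmetric] nat_trans_square[OF s])
      finally show ?thesis using X Y f by (simp add: algebra_hom_def Nh)
    qed
    have Nmu: "algebra_hom C G (omap N (omap N X)) (c (omap N X)) (omap N X) (c X) (mu N X)"
      if X: "X \<in> Ob C" for X
    proof -
      have "cmp C (omap G (omap N (omap N X))) (omap N (omap N X)) (omap N X) (mu N X) (c (omap N X)) =
        cmp C (omap G (omap N (omap N X))) (omap N (omap N X)) (omap N X) (mu N X)
          (cmp C (omap G (omap N (omap N X))) (omap N (omap N (omap N X))) (omap N (omap N X))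
            (amap N (omap N (omap N X)) (omap N X) (mu N X)) (s (omap N (omap N X))))"
        unfolding c_def using X mu_assoc[OF N X]
        by (intro cmp_eq_cmp) (simp_all add: homs Nh)
      also have "\<dots> = cmp C (omap G (omap N (omap N X))) (omap G (omap N X)) (omap N X) (c X)
          (amap G (omap N (omap N X)) (omap N X) (mu N X))"
        using X by (simp add: c_def homs Nh cmp_assoc[symmetric] nat_trans_square[OF s])
      finally show ?thesis using X by (simp add: algebra_hom_def Nh)
    qed
    \<comment> \<open>The choice is forced: a monad morphism preserves units, and compatibility with
      \<open>s\<close> makes it an algebra homomorphism, as \<open>unique\<close> shows.\<close>
    define h where "h X = (THE k. algebra_hom C G (omap M X) (a X) (omap N X) (c X) k \<and>
        cmp C X (omap M X) (omap N X) k (eta M X) = eta N X)" for X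
    have h: "algebra_hom C G (omap M X) (a X) (omap N X) (c X) (h X) \<and>
        cmp C X (omap M X) (omap N X) (h X) (eta M X) = eta N X" if X: "X \<in> Ob C" for X
      unfolding h_def by (rule theI'[OF free_algebra_ex1[OF free c_alg]]) (use X in \<open>simp_all add: Nh\<close>)
    have h_alg: "algebra_hom C G (omap M X) (a X) (omap N X) (c X) (h X)" if X: "X \<in> Ob C" for X
      using h X by blast
    have h_eta: "cmp C X (omap M X) (omap N X) (h X) (eta M X) = eta N X" if X: "X \<in> Ob C" for X
      using h X by blast
    have h_hom: "h X \<in> Hom C (omap M X) (omap N X)" if X: "X \<in> Ob C" for X
      using h_alg[OF X] by (simp add: algebra_hom_def)
    have h_nat: "cmp C (omap M X) (omap M Y) (omap N Y) (h Y) (amap M X Y f) =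
        cmp C (omap M X) (omap N X) (omap N Y) (amap N X Y f) (h X)" (is "?l = ?r")
      if X: "X \<in> Ob C" and Y: "Y \<in> Ob C" and f: "f \<in> Hom C X Y" for X Y f
    proof (rule free_algebra_hom_eq[OF free c_alg])
      show "algebra_hom C G (omap M X) (a X) (omap N Y) (c Y) ?l"
        by (rule algebra_hom_cmp[OF endo_G free_alg free_alg c_alg])
          (use X Y f in \<open>simp_all add: alg_homs h_alg\<close>)
      show "algebra_hom C G (omap M X) (a X) (omap N Y) (c Y) ?r"
        by (rule algebra_hom_cmp[OF endo_G free_alg c_alg c_alg])
          (use X Y f in \<open>simp_all add: Nmap h_alg\<close>)
      \<comment> \<open>On generators both sides are \<open>eta N Y\<close> after
        \<open>f\<close>.\<close>
      have "cmp C X (omap M X) (omap N Y) ?l (eta M X) =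
          cmp C X (omap M Y) (omap N Y) (h Y) (cmp C X Y (omap M Y) (eta M Y) f)"
        using X Y f by (simp add: cmp_assoc[symmetric] homs Nh h_hom map_eta)
      also have "\<dots> = cmp C X Y (omap N Y) (eta N Y) f"
        using X Y f by (simp add: cmp_assoc homs Nh h_hom h_eta)
      also have "\<dots> = cmp C X (omap M X) (omap N Y) ?r (eta M X)"
        using X Y f by (simp add: cmp_assoc[symmetric] homs Nh h_hom h_eta eta_natural[OF N])
      finally show "cmp C X (omap M X) (omap N Y) ?l (eta M X) =
          cmp C X (omap M X) (omap N Y) ?r (eta M X)" .
    qed (use X Y f in simp_all)
    have h_mu: "cmp C (omap M (omap M X)) (omap M X) (omap N X) (h X) (mu M X) =
        cmp C (omap M (omap M X)) (omap N (omap N X)) (omap N X) (mu N X)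
          (cmp C (omap M (omap M X)) (omap N (omap M X)) (omap N (omap N X))
            (amap N (omap M X) (omap N X) (h X)) (h (omap M X)))" (is "?l = ?r")
      if X: "X \<in> Ob C" for X
    proof (rule free_algebra_hom_eq[OF free c_alg])
      show "algebra_hom C G (omap M (omap M X)) (a (omap M X)) (omap N X) (c X) ?l"
        by (rule algebra_hom_cmp[OF endo_G free_alg free_alg c_alg])
          (use X in \<open>simp_all add: alg_homs homs h_alg\<close>)
      show "algebra_hom C G (omap M (omap M X)) (a (omap M X)) (omap N X) (c X) ?r"
        by (rule algebra_hom_cmp[OF endo_G free_alg c_alg c_alg],
            simp_all add: X Nmu homs Nh,
            rule algebra_hom_cmp[OF endo_G free_alg c_alg c_alg],
            simp_all add: X Nmap homs Nh h_hom h_alg)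
      \<comment> \<open>On the generators \<open>omap M X\<close> both sides restrict to
        \<open>h X\<close>.\<close>
      have "cmp C (omap M X) (omap M (omap M X)) (omap N X) ?r (eta M (omap M X)) =
         cmp C (omap M X) (omap N (omap N X)) (omap N X) (mu N X)
          (cmp C (omap M X) (omap N (omap M X)) (omap N (omap N X))
            (amap N (omap M X) (omap N X) (h X)) (eta N (omap M X)))"
        using X by (simp add: cmp_assoc[symmetric] homs Nh h_hom h_eta)
      also have "\<dots> = cmp C (omap M X) (omap N (omap N X)) (omap N X) (mu N X)
          (cmp C (omap M X) (omap N X) (omap N (omap N X)) (eta N (omap N X)) (h X))"
        using X by (simp add: eta_natural[OF N] homs Nh h_hom)
      also have "\<dots> = h X"
        using X by (simp add: cmp_assoc homs Nh h_hom mu_eta[OF N])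
      finally show "cmp C (omap M X) (omap M (omap M X)) (omap N X) ?l (eta M (omap M X)) =
          cmp C (omap M X) (omap M (omap M X)) (omap N X) ?r (eta M (omap M X))"
        using X by (simp add: cmp_assoc[symmetric] homs h_hom Nh mult_eta)
    qed (use X in \<open>simp_all add: homs\<close>)
    have morphism: "monad_morphism C M N h"
      using h_hom h_nat h_eta h_mu by (simp add: monad_morphism_def nat_trans_def)
    \<comment> \<open>The homomorphism square of \<open>h X\<close>, restricted to generators,
      leaves \<open>c X\<close> after the \<open>G\<close>-image of \<open>eta N X\<close>.
      Naturality of \<open>s\<close> and a unit law of \<open>N\<close> reduce this to
      \<open>s X\<close>.\<close>
    have h_\<nu>: "cmp C (omap G X) (omap M X) (omap N X) (h X) (\<nu> X) = s X" if X: "X \<in> Ob C" for X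
    proof -
      have "cmp C (omap G X) (omap M X) (omap N X) (h X) (\<nu> X) =
        cmp C (omap G X) (omap G (omap N X)) (omap N X) (c X)
          (cmp C (omap G X) (omap G (omap M X)) (omap G (omap N X))
            (amap G (omap M X) (omap N X) (h X)) (amap G X (omap M X) (eta M X)))"
        unfolding \<nu>_def using X h_alg[OF X]
        by (intro cmp_eq_cmp) (simp_all add: homs Nh h_hom algebra_hom_def c_def)
      also have "\<dots> = cmp C (omap G X) (omap G (omap N X)) (omap N X) (c X) (amap G X (omap N X) (eta N X))"
        using X functor_cmp[OF endo_G, of X "omap M X" "omap N X" "eta M X" "h X"]
        by (simp add: homs Nh h_hom h_eta)
      also have "\<dots> = cmp C (omap G X) (omap N (omap N X)) (omap N X) (mu N X)
          (cmp C (omap G X) (omap N X) (omap N (omap N X)) (amap N X (omap N X) (eta N X)) (s X))"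
        using X by (simp add: c_def homs Nh cmp_assoc[symmetric] nat_trans_square[OF s])
      also have "\<dots> = s X"
        using X by (simp add: cmp_assoc homs Nh mu_map_eta[OF N])
      finally show ?thesis .
    qed
    have unique: "h' X = h X"
      if h': "monad_morphism C M N h'"
        and h'_\<nu>: "\<forall>X\<in>Ob C. cmp C (omap G X) (omap M X) (omap N X) (h' X) (\<nu> X) = s X"
        and X: "X \<in> Ob C" for h' X
    proof (rule free_algebra_hom_eq[OF free c_alg])
      have h'_hom: "h' Y \<in> Hom C (omap M Y) (omap N Y)" if "Y \<in> Ob C" for Y
        using h' that by (simp add: monad_morphism_def nat_trans_def)
      \<comment> \<open>That \<open>h'\<close> is a homomorphism follows by writing
        \<open>a X\<close> as in \<open>str_eq\<close>, moving \<open>h'\<close> past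
        \<open>mu M X\<close>, replacing \<open>h'\<close> after \<open>\<nu>\<close> by
        \<open>s\<close>, and applying naturality of \<open>s\<close> at
        \<open>h' X\<close>.\<close>
      have "cmp C (omap G (omap M X)) (omap M X) (omap N X) (h' X) (a X) =
        cmp C (omap G (omap M X)) (omap M X) (omap N X) (h' X)
          (cmp C (omap G (omap M X)) (omap M (omap M X)) (omap M X) (mu M X) (\<nu> (omap M X)))"
        using str_eq[OF X] by simp
      also have "\<dots> = cmp C (omap G (omap M X)) (omap N (omap N X)) (omap N X) (mu N X)
          (cmp C (omap G (omap M X)) (omap M (omap M X)) (omap N (omap N X))
            (cmp C (omap M (omap M X)) (omap N (omap M X)) (omap N (omap N X))
              (amap N (omap M X) (omap N X) (h' X)) (h' (omap M X))) (\<nu> (omap M X)))"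
        using X h' by (intro cmp_eq_cmp) (simp_all add: homs Nh \<nu>_hom h'_hom monad_morphism_def Let_def)
      also have "\<dots> = cmp C (omap G (omap M X)) (omap N (omap N X)) (omap N X) (mu N X)
          (cmp C (omap G (omap M X)) (omap N (omap M X)) (omap N (omap N X))
              (amap N (omap M X) (omap N X) (h' X)) (s (omap M X)))"
        using X h'_\<nu> by (simp add: cmp_assoc[symmetric] homs Nh \<nu>_hom h'_hom)
      also have "\<dots> = cmp C (omap G (omap M X)) (omap G (omap N X)) (omap N X) (c X)
          (amap G (omap M X) (omap N X) (h' X))"
        using X by (simp add: c_def homs Nh h'_hom cmp_assoc[symmetric] nat_trans_square[OF s])
      finally show "algebra_hom C G (omap M X) (a X) (omap N X) (c X) (h' X)"
        using X by (simp add: algebra_hom_def h'_hom)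
      show "cmp C X (omap M X) (omap N X) (h' X) (eta M X) =
          cmp C X (omap M X) (omap N X) (h X) (eta M X)"
        using X h' by (simp add: h_eta monad_morphism_def Let_def)
    qed (use X h_alg in simp_all)
    show ?thesis using morphism h_\<nu> unique by blast
  qed
  with is_monad \<nu> show ?thesis
    unfolding free_monad_over_def Let_def by blast
qed

end


section \<open>Coproducts, and free algebras from initial algebras\<close>

locale coproduct_category = category C for C :: "('o, 'm) cat" +
  fixes P :: "('o, 'm) coprod"
  assumes coproducts: "binary_coproducts C P"
begin

lemma csum_ob: "X \<in> Ob C \<Longrightarrow> Y \<in> Ob C \<Longrightarrow> csum P X Y \<in> Ob C"
  using coproducts by (simp add: binary_coproducts_def)

lemma inl_hom: "X \<in> Ob C \<Longrightarrow> Y \<in> Ob C \<Longrightarrow> inl P X Y \<in> Hom C X (csum P X Y)"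
  using coproducts by (simp add: binary_coproducts_def)

lemma inr_hom: "X \<in> Ob C \<Longrightarrow> Y \<in> Ob C \<Longrightarrow> inr P X Y \<in> Hom C Y (csum P X Y)"
  using coproducts by (simp add: binary_coproducts_def)

lemma copair_ex1:
  "\<lbrakk>X \<in> Ob C; Y \<in> Ob C; Z \<in> Ob C; f \<in> Hom C X Z; g \<in> Hom C Y Z\<rbrakk>
    \<Longrightarrow> \<exists>!h. is_copair C P X Y Z f g h"
  using coproducts unfolding binary_coproducts_def by blast

lemma is_copair_copair:
  "\<lbrakk>X \<in> Ob C; Y \<in> Ob C; Z \<in> Ob C; f \<in> Hom C X Z; g \<in> Hom C Y Z\<rbrakk>
    \<Longrightarrow> is_copair C P X Y Z f g (copair C P X Y Z f g)"
  unfolding copair_def by (rule theI'[OF copair_ex1])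

lemma copair_rules:
  assumes "X \<in> Ob C" "Y \<in> Ob C" "Z \<in> Ob C" "f \<in> Hom C X Z" "g \<in> Hom C Y Z"
  shows "copair C P X Y Z f g \<in> Hom C (csum P X Y) Z"
    and "cmp C X (csum P X Y) Z (copair C P X Y Z f g) (inl P X Y) = f"
    and "cmp C Y (csum P X Y) Z (copair C P X Y Z f g) (inr P X Y) = g"
  using is_copair_copair[OF assms] by (simp_all add: is_copair_def)

lemma csum_hom_eq_iff:
  assumes "X \<in> Ob C" "Y \<in> Ob C" "Z \<in> Ob C"
    and "h \<in> Hom C (csum P X Y) Z" "k \<in> Hom C (csum P X Y) Z"
  shows "h = k \<longleftrightarrow>
    cmp C X (csum P X Y) Z h (inl P X Y) = cmp C X (csum P X Y) Z k (inl P X Y) \<and>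
    cmp C Y (csum P X Y) Z h (inr P X Y) = cmp C Y (csum P X Y) Z k (inr P X Y)"
  using copair_ex1[OF assms(1-3), of "cmp C X (csum P X Y) Z k (inl P X Y)"
      "cmp C Y (csum P X Y) Z k (inr P X Y)"] assms
  unfolding is_copair_def by (metis cmp_hom csum_ob inl_hom inr_hom)

lemmas sum_homs = csum_ob inl_hom inr_hom copair_rules(1) cmp_hom ide_hom

lemma csum_map_rules:
  assumes "X \<in> Ob C" "Y \<in> Ob C" "X' \<in> Ob C" "Y' \<in> Ob C" "f \<in> Hom C X X'" "g \<in> Hom C Y Y'"
  shows "csum_map C P X Y X' Y' f g \<in> Hom C (csum P X Y) (csum P X' Y')"
    and "cmp C X (csum P X Y) (csum P X' Y') (csum_map C P X Y X' Y' f g) (inl P X Y) =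
      cmp C X X' (csum P X' Y') (inl P X' Y') f"
    and "cmp C Y (csum P X Y) (csum P X' Y') (csum_map C P X Y X' Y' f g) (inr P X Y) =
      cmp C Y Y' (csum P X' Y') (inr P X' Y') g"
  using assms by (simp_all add: csum_map_def copair_rules sum_homs)

text \<open>The coprojections are jointly epic, so the square splits into its two restrictions. The
  \<open>F(-) + X\<close>-homomorphism condition and the defining equations of
  \<open>star_endo\<close> and \<open>star_mult\<close> all have this shape; each becomes an
  \<open>F\<close>-homomorphism condition plus a condition on generators.\<close>

lemma sum_square_iff:
  assumes obs: "U \<in> Ob C" "X \<in> Ob C" "A \<in> Ob C" "V \<in> Ob C" "Y \<in> Ob C" "B \<in> Ob C"
    and homs: "i \<in> Hom C (csum P U X) A" "j \<in> Hom C (csum P V Y) B"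
      "h \<in> Hom C A B" "u \<in> Hom C U V" "f \<in> Hom C X Y"
  shows "cmp C (csum P U X) A B h i =
      cmp C (csum P U X) (csum P V Y) B j (csum_map C P U X V Y u f) \<longleftrightarrow>
    cmp C U A B h (cmp C U (csum P U X) A i (inl P U X)) =
      cmp C U V B (cmp C V (csum P V Y) B j (inl P V Y)) u \<and>
    cmp C X A B h (cmp C X (csum P U X) A i (inr P U X)) =
      cmp C X Y B (cmp C Y (csum P V Y) B j (inr P V Y)) f"
  using assms
  by (subst csum_hom_eq_iff[of U X B])
    (simp_all add: sum_homs csum_map_rules cmp_assoc[symmetric])

text \<open>An \<open>F\<close>-algebra \<open>b\<close> on \<open>B\<close> with an arrow
  \<open>f\<close> from \<open>X\<close> amounts to the \<open>F(-) + X\<close>-algebra given by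
  their copair. Homomorphisms from \<open>A\<close> into the latter are exactly the extensions of
  \<open>f\<close>, so initiality gives existence and uniqueness.\<close>

lemma free_algebra_of_initial:
  assumes F: "endofunctor C F" and X: "X \<in> Ob C"
    and init: "initial_algebra C (plus_const C P F X) A i"
  shows "free_algebra C F X A (cmp C (omap F A) (csum P (omap F A) X) A i (inl P (omap F A) X))
      (cmp C X (csum P (omap F A) X) A i (inr P (omap F A) X))"
    (is "free_algebra C F X A ?a ?e")
proof -
  note FF = functor_rules[OF F]
  have A: "A \<in> Ob C" and i: "i \<in> Hom C (csum P (omap F A) X) A"
    using init by (simp_all add: initial_algebra_def algebra_def plus_const_def)
  have "\<exists>!h. algebra_hom C F A ?a B b h \<and> cmp C X A B h ?e = f"
    if "algebra C F B b" and f: "f \<in> Hom C X B" for B b f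
  proof -
    have B: "B \<in> Ob C" and b: "b \<in> Hom C (omap F B) B"
      using that by (simp_all add: algebra_def)
    let ?j = "copair C P (omap F B) X B b f"
    have j: "?j \<in> Hom C (csum P (omap F B) X) B"
      using X B b f by (simp add: copair_rules FF)
    have eq: "algebra_hom C (plus_const C P F X) A i B ?j h \<longleftrightarrow>
        algebra_hom C F A ?a B b h \<and> cmp C X A B h ?e = f" for h
    proof (cases "h \<in> Hom C A B")
      case True
      then show ?thesis
        using X A B b f i j
        by (simp add: algebra_hom_def plus_const_def sum_square_iff FF ide_hom copair_rules cmp_ide_right)
    qed (simp add: algebra_hom_def)
    have "algebra C (plus_const C P F X) B ?j"
      using B j by (simp add: algebra_def plus_const_def)
    with init have "\<exists>!h. algebra_hom C (plus_const C P F X) A i B ?j h"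
      by (simp add: initial_algebra_def)
    then show ?thesis by (simp only: eq)
  qed
  then show ?thesis
    using X A i by (simp add: free_algebra_def algebra_def sum_homs FF)
qed

end

section \<open>Functor and multiplication of the free monad as homomorphic extensions\<close>

text \<open>Freeness is assumed instead of initiality, so that the Kleisli instance can be obtained
  by transporting free algebras, without going through initial algebras there.\<close>

locale star_algebras = coproduct_category C P
  for C :: "('o, 'm) cat" and P :: "('o, 'm) coprod" +
  fixes F :: "('o, 'm) endo" and S :: "'o \<Rightarrow> 'o" and i :: "'o \<Rightarrow> 'm"
  assumes endo_F: "endofunctor C F"
    and carrier_ob: "X \<in> Ob C \<Longrightarrow> S X \<in> Ob C"
    and str_hom: "X \<in> Ob C \<Longrightarrow> i X \<in> Hom C (csum P (omap F (S X)) X) (S X)"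
    and free_str: "X \<in> Ob C \<Longrightarrow> free_algebra C F X (S X)
      (cmp C (omap F (S X)) (csum P (omap F (S X)) X) (S X) (i X) (inl P (omap F (S X)) X))
      (cmp C X (csum P (omap F (S X)) X) (S X) (i X) (inr P (omap F (S X)) X))"
begin

text \<open>The free \<open>F\<close>-algebra structure on \<open>S X\<close>; the other half of
  \<open>i X\<close> is \<open>star_unit\<close>.\<close>

definition op where
  "op X = cmp C (omap F (S X)) (csum P (omap F (S X)) X) (S X) (i X) (inl P (omap F (S X)) X)"

lemma free_op: "X \<in> Ob C \<Longrightarrow> free_algebra C F X (S X) (op X) (star_unit C P F S i X)"
  using free_str by (simp add: op_def star_unit_def)

lemma op_algebra: "X \<in> Ob C \<Longrightarrow> algebra C F (S X) (op X)"
  using free_op by (simp add: free_algebra_def)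

lemma star_unit_hom: "X \<in> Ob C \<Longrightarrow> star_unit C P F S i X \<in> Hom C X (S X)"
  using free_op by (simp add: free_algebra_def)

lemmas star_homs = sum_homs carrier_ob str_hom star_unit_hom functor_rules[OF endo_F]

text \<open>By \<open>sum_square_iff\<close> the equation under the description operator
  characterises the homomorphism extending \<open>star_unit\<close> after \<open>f\<close>, so
  freeness makes the description well defined.\<close>

lemma star_map:
  assumes X: "X \<in> Ob C" and Y: "Y \<in> Ob C" and f: "f \<in> Hom C X Y"
  defines "k \<equiv> amap (star_endo C P F S i) X Y f"
  shows "algebra_hom C F (S X) (op X) (S Y) (op Y) k"
    and "cmp C X (S X) (S Y) k (star_unit C P F S i X) = cmp C X Y (S Y) (star_unit C P F S i Y) f"
proof -
  have eq: "(h \<in> Hom C (S X) (S Y) \<and>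
        cmp C (csum P (omap F (S X)) X) (S X) (S Y) h (i X) =
        cmp C (csum P (omap F (S X)) X) (csum P (omap F (S Y)) Y) (S Y) (i Y)
          (csum_map C P (omap F (S X)) X (omap F (S Y)) Y (amap F (S X) (S Y) h) f)) \<longleftrightarrow>
      algebra_hom C F (S X) (op X) (S Y) (op Y) h \<and>
      cmp C X (S X) (S Y) h (star_unit C P F S i X) =
        cmp C X Y (S Y) (star_unit C P F S i Y) f" for h
  proof (cases "h \<in> Hom C (S X) (S Y)")
    case True
    then show ?thesis using X Y f
      by (simp add: sum_square_iff star_homs algebra_hom_def op_def star_unit_def)
  qed (simp add: algebra_hom_def)
  have "algebra_hom C F (S X) (op X) (S Y) (op Y) k \<and>
      cmp C X (S X) (S Y) k (star_unit C P F S i X) =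
        cmp C X Y (S Y) (star_unit C P F S i Y) f"
    unfolding k_def star_endo_def endo.simps eq
    by (rule theI'[OF free_algebra_ex1[OF free_op op_algebra]])
      (use X Y f in \<open>simp_all add: star_homs\<close>)
  then show "algebra_hom C F (S X) (op X) (S Y) (op Y) k"
    and "cmp C X (S X) (S Y) k (star_unit C P F S i X) = cmp C X Y (S Y) (star_unit C P F S i Y) f"
    by simp_all
qed

text \<open>As for \<open>star_map\<close>: the copair of \<open>op X\<close> and the identity makes
  the defining equation say that \<open>k\<close> is the homomorphism extending the identity of
  \<open>S X\<close>.\<close>

lemma star_mult:
  assumes X: "X \<in> Ob C"
  defines "k \<equiv> star_mult C P F S i X"
  shows "algebra_hom C F (S (S X)) (op (S X)) (S X) (op X) k"
    and "cmp C (S X) (S (S X)) (S X) k (star_unit C P F S i (S X)) = ide C (S X)"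
proof -
  have op_hom: "op X \<in> Hom C (omap F (S X)) (S X)"
    using op_algebra[OF X] by (simp add: algebra_def)
  have eq: "(h \<in> Hom C (S (S X)) (S X) \<and>
        cmp C (csum P (omap F (S (S X))) (S X)) (S (S X)) (S X) h (i (S X)) =
        cmp C (csum P (omap F (S (S X))) (S X)) (csum P (omap F (S X)) (S X)) (S X)
          (copair C P (omap F (S X)) (S X) (S X) (op X) (ide C (S X)))
          (csum_map C P (omap F (S (S X))) (S X) (omap F (S X)) (S X)
             (amap F (S (S X)) (S X) h) (ide C (S X)))) \<longleftrightarrow>
      algebra_hom C F (S (S X)) (op (S X)) (S X) (op X) h \<and>
      cmp C (S X) (S (S X)) (S X) h (star_unit C P F S i (S X)) = ide C (S X)" for h
  proof (cases "h \<in> Hom C (S (S X)) (S X)")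
    case True
    then show ?thesis using X op_hom
      by (simp add: sum_square_iff star_homs algebra_hom_def star_unit_def
          copair_rules cmp_ide_right op_def[of "S X"])
  qed (simp add: algebra_hom_def)
  have "algebra_hom C F (S (S X)) (op (S X)) (S X) (op X) k \<and>
      cmp C (S X) (S (S X)) (S X) k (star_unit C P F S i (S X)) = ide C (S X)"
    unfolding k_def star_mult_def Let_def op_def[of X, symmetric] eq
    by (rule theI'[OF free_algebra_ex1[OF free_op op_algebra]])
      (use X in \<open>simp_all add: star_homs\<close>)
  then show "algebra_hom C F (S (S X)) (op (S X)) (S X) (op X) k"
    and "cmp C (S X) (S (S X)) (S X) k (star_unit C P F S i (S X)) = ide C (S X)"
    by simp_all
qed

end

section \<open>The Kleisli category and the transport of free algebras to it\<close>

locale kleisli_setup = category C for C :: "('o, 'm) cat" +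
  fixes T :: "('o, 'm) monad_data"
  assumes monad_T: "monad C T"
begin

abbreviation "K \<equiv> kleisli C T"

lemmas Th = monad_rules[OF monad_T] cmp_hom ide_hom

lemma kleisli_simps: "Ob K = Ob C" "Hom K X Y = Hom C X (omap T Y)" "ide K = eta T"
  by (simp_all add: kleisli_def)

lemma sharp_hom: "\<lbrakk>X \<in> Ob C; Y \<in> Ob C; f \<in> Hom C X Y\<rbrakk> \<Longrightarrow> sharp C T X Y f \<in> Hom C X (omap T Y)"
  by (simp add: sharp_def Th)

lemma kleisli_cmp_hom:
  "\<lbrakk>X \<in> Ob C; Y \<in> Ob C; Z \<in> Ob C; f \<in> Hom C X (omap T Y); g \<in> Hom C Y (omap T Z)\<rbrakk>
    \<Longrightarrow> cmp K X Y Z g f \<in> Hom C X (omap T Z)"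
  by (simp add: kleisli_def Th)

text \<open>Naturality of \<open>eta\<close> moves the unit past \<open>g\<close>, where it cancels
  against \<open>mu\<close>. Kleisli precomposition with a sharp arrow is thus plain precomposition
  in \<open>C\<close>.\<close>

lemma kleisli_cmp_sharp:
  assumes X: "X \<in> Ob C" and Y: "Y \<in> Ob C" and Z: "Z \<in> Ob C"
    and f: "f \<in> Hom C X Y" and g: "g \<in> Hom C Y (omap T Z)"
  shows "cmp K X Y Z g (sharp C T X Y f) = cmp C X Y (omap T Z) g f"
proof -
  have "cmp K X Y Z g (sharp C T X Y f) =
    cmp C X (omap T (omap T Z)) (omap T Z) (mu T Z)
      (cmp C X Y (omap T (omap T Z)) (cmp C Y (omap T Y) (omap T (omap T Z))
         (amap T Y (omap T Z) g) (eta T Y)) f)"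
    using assms by (simp add: kleisli_def sharp_def Th cmp_assoc)
  also have "\<dots> = cmp C X (omap T (omap T Z)) (omap T Z) (mu T Z)
      (cmp C X Y (omap T (omap T Z)) (cmp C Y (omap T Z) (omap T (omap T Z))
         (eta T (omap T Z)) g) f)"
    using assms by (simp add: eta_natural[OF monad_T] Th)
  also have "\<dots> = cmp C X Y (omap T Z) (cmp C Y (omap T Z) (omap T Z)
      (cmp C (omap T Z) (omap T (omap T Z)) (omap T Z) (mu T Z) (eta T (omap T Z))) g) f"
    using assms by (simp add: cmp_assoc Th)
  also have "\<dots> = cmp C X Y (omap T Z) g f"
    using assms by (simp add: mu_eta[OF monad_T] cmp_ide_left Th)
  finally show ?thesis .
qed

lemma sharp_ide: "X \<in> Ob C \<Longrightarrow> sharp C T X X (ide C X) = eta T X"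
  by (simp add: sharp_def cmp_ide_right Th)

lemma category_kleisli: "category K"
proof (unfold_locales, simp_all only: kleisli_simps)
  fix X Y f assume X: "X \<in> Ob C" and Y: "Y \<in> Ob C" and f: "f \<in> Hom C X (omap T Y)"
  show "cmp K X Y Y (eta T Y) f = f"
    using X Y f by (simp add: kleisli_def cmp_assoc Th mu_map_eta[OF monad_T] cmp_ide_left)
  show "cmp K X X Y f (eta T X) = f"
    using kleisli_cmp_sharp[OF X X Y ide_hom[OF X] f] X Y f by (simp add: sharp_ide cmp_ide_right Th)
next
  fix W X Y Z f g h
  assume W: "W \<in> Ob C" and X: "X \<in> Ob C" and Y: "Y \<in> Ob C" and Z: "Z \<in> Ob C"
    and f: "f \<in> Hom C W (omap T X)" and g: "g \<in> Hom C X (omap T Y)"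
    and h: "h \<in> Hom C Y (omap T Z)"
  let ?TX = "omap T X" and ?TY = "omap T Y" and ?TZ = "omap T Z"
  let ?TTY = "omap T (omap T Y)" and ?TTZ = "omap T (omap T Z)"
  let ?TTTZ = "omap T (omap T (omap T Z))"
  let ?k = "cmp C W ?TX ?TTY (amap T X ?TY g) f"
  let ?Th = "amap T Y ?TZ h"
  have k: "?k \<in> Hom C W ?TTY" using W X Y f g by (simp add: Th)
  \<comment> \<open>Naturality moves \<open>mu T Y\<close> past the image of \<open>h\<close>,
    \<open>mu_assoc\<close> trades one of the two resulting multiplications for an image under
    \<open>T\<close>, and functoriality of \<open>T\<close> regroups the result.\<close>
  have "cmp K W Y Z h (cmp K W X Y g f) =
    cmp C W ?TTZ ?TZ (mu T Z) (cmp C W ?TY ?TTZ ?Th (cmp C W ?TTY ?TY (mu T Y) ?k))"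
    by (simp add: kleisli_def)
  also have "cmp C W ?TY ?TTZ ?Th (cmp C W ?TTY ?TY (mu T Y) ?k) =
    cmp C W ?TTTZ ?TTZ (mu T ?TZ) (cmp C W ?TTY ?TTTZ (amap T ?TY ?TTZ ?Th) ?k)"
    using W Y Z h k mu_natural[OF monad_T Y _ h] by (intro cmp_eq_cmp) (simp_all add: Th)
  also have "cmp C W ?TTZ ?TZ (mu T Z)
      (cmp C W ?TTTZ ?TTZ (mu T ?TZ) (cmp C W ?TTY ?TTTZ (amap T ?TY ?TTZ ?Th) ?k)) =
    cmp C W ?TTZ ?TZ (mu T Z)
      (cmp C W ?TTTZ ?TTZ (amap T ?TTZ ?TZ (mu T Z)) (cmp C W ?TTY ?TTTZ (amap T ?TY ?TTZ ?Th) ?k))"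
    using W Y Z h k mu_assoc[OF monad_T Z] by (intro cmp_eq_cmp) (simp_all add: Th)
  also have "\<dots> = cmp K W X Z (cmp K X Y Z h g) f"
    using W X Y Z f g h by (simp add: kleisli_def cmp_assoc Th)
  finally show "cmp K W Y Z h (cmp K W X Y g f) = cmp K W X Z (cmp K X Y Z h g) f" .
qed (simp_all add: Th kleisli_cmp_hom)

lemma sharp_cmp:
  assumes "X \<in> Ob C" "Y \<in> Ob C" "Z \<in> Ob C" "f \<in> Hom C X Y" "g \<in> Hom C Y Z"
  shows "cmp K X Y Z (sharp C T Y Z g) (sharp C T X Y f) = sharp C T X Z (cmp C X Y Z g f)"
  using assms by (simp add: kleisli_cmp_sharp sharp_hom) (simp add: sharp_def cmp_assoc Th)

text \<open>The coprojections are sharp, so by \<open>kleisli_cmp_sharp\<close> a Kleisli copair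
  into \<open>Z\<close> is literally a copair in \<open>C\<close> into
  \<open>omap T Z\<close>.\<close>

lemma binary_coproducts_kleisli:
  assumes "binary_coproducts C P"
  shows "binary_coproducts K (kleisli_coprod C T P)"
proof -
  interpret coproduct_category C P by unfold_locales (rule assms)
  have "is_copair K (kleisli_coprod C T P) X Y Z f g = is_copair C P X Y (omap T Z) f g"
    if "X \<in> Ob C" "Y \<in> Ob C" "Z \<in> Ob C" for X Y Z f g
    using that
    by (intro ext) (auto simp: is_copair_def kleisli_coprod_def kleisli_simps kleisli_cmp_sharp
        inl_hom inr_hom csum_ob)
  then show ?thesis
    by (simp add: binary_coproducts_def kleisli_simps Th copair_ex1)
      (simp add: kleisli_coprod_def csum_ob sharp_hom inl_hom inr_hom)
qed

text \<open>
  A \<open>G\<close>-algebra \<open>b\<close> on \<open>B\<close> in the Kleisli category turns \<open>T B\<close> into an \<open>F\<close>-algebra \<open>b \<cdot> \<lambda>\<^sub>B\<close>,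
  where \<open>\<lambda>\<^sub>B = G (id\<^bsub>T B\<^esub>)\<close>, the identity being read as a Kleisli morphism \<open>T B \<leadsto> B\<close>. Since
  \<open>\<lambda>\<^sub>B \<circ> F h = G h\<close>, the homomorphisms from \<open>a\<^sup>\<sharp>\<close> to \<open>b\<close> are those from \<open>a\<close> to \<open>b \<cdot> \<lambda>\<^sub>B\<close>.
\<close>

lemma free_algebra_kleisli:
  assumes F: "endofunctor C F" and lift: "lifts_to C T F G" and X: "X \<in> Ob C"
    and free: "free_algebra C F X A a e"
  shows "free_algebra K G X A (sharp C T (omap F A) A a) (sharp C T X A e)"
proof -
  note FF = functor_rules[OF F]
  have G: "endofunctor K G" and G_ob: "\<And>X. X \<in> Ob C \<Longrightarrow> omap G X = omap F X"
    and G_sharp: "\<And>X Y f. \<lbrakk>X \<in> Ob C; Y \<in> Ob C; f \<in> Hom C X Y\<rbrakk> \<Longrightarrow>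
        amap G X Y (sharp C T X Y f) = sharp C T (omap F X) (omap F Y) (amap F X Y f)"
    using lift by (auto simp: lifts_to_def)
  have G_hom: "amap G X Y f \<in> Hom C (omap F X) (omap T (omap F Y))"
    if "X \<in> Ob C" "Y \<in> Ob C" "f \<in> Hom C X (omap T Y)" for X Y f
    using functor_hom[OF G, of X Y f] that by (simp add: kleisli_simps G_ob)
  have A: "A \<in> Ob C" and a: "a \<in> Hom C (omap F A) A" and e: "e \<in> Hom C X A"
    using free by (auto simp: free_algebra_def algebra_def)
  have "\<exists>!h. algebra_hom K G A (sharp C T (omap F A) A a) B b h \<and>
      cmp K X A B h (sharp C T X A e) = f"
    if "algebra K G B b" and f: "f \<in> Hom K X B" for B b f
  proof -
    have B: "B \<in> Ob C" and b: "b \<in> Hom C (omap F B) (omap T B)"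
      using that by (auto simp: algebra_def kleisli_simps G_ob)
    let ?TB = "omap T B"
    define l where "l = amap G ?TB B (ide C ?TB)"
    have l: "l \<in> Hom C (omap F ?TB) (omap T (omap F B))"
      unfolding l_def using B by (intro G_hom) (simp_all add: Th)
    define b' where "b' = cmp K (omap F ?TB) (omap F B) B b l"
    have b': "b' \<in> Hom C (omap F ?TB) ?TB"
      unfolding b'_def using B b l by (intro kleisli_cmp_hom) (simp_all add: FF Th)
    have eq: "algebra_hom K G A (sharp C T (omap F A) A a) B b h \<and>
        cmp K X A B h (sharp C T X A e) = f \<longleftrightarrow>
      algebra_hom C F A a ?TB b' h \<and> cmp C X A ?TB h e = f" for h
    proof (cases "h \<in> Hom C A ?TB")
      case h: True
      have TB: "?TB \<in> Ob C" and FA: "omap F A \<in> Ob C" and FB: "omap F B \<in> Ob C"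
          and FTB: "omap F ?TB \<in> Ob C" and Fh: "amap F A ?TB h \<in> Hom C (omap F A) (omap F ?TB)"
        using A B h by (simp_all add: Th FF)
      \<comment> \<open>The arrow \<open>h\<close> is the Kleisli composite of the identity on
        \<open>?TB\<close>, read as an arrow to \<open>B\<close>, after the sharp of
        \<open>h\<close>. The lifting preserves this composite and acts on the sharp arrow through
        \<open>F\<close>.\<close>
      have "amap G A B h = amap G A B (cmp K A ?TB B (ide C ?TB) (sharp C T A ?TB h))"
        using A B h by (simp add: kleisli_cmp_sharp Th cmp_ide_left)
      also have "\<dots> = cmp K (omap F A) (omap F ?TB) (omap F B) l (amap G A ?TB (sharp C T A ?TB h))"
        using functor_cmp[OF G, of A ?TB B "sharp C T A ?TB h" "ide C ?TB"] A B h
        by (simp add: kleisli_simps l_def G_ob sharp_hom Th)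
      also have "\<dots> = cmp K (omap F A) (omap F ?TB) (omap F B) l
          (sharp C T (omap F A) (omap F ?TB) (amap F A ?TB h))"
        using A TB h by (simp add: G_sharp)
      finally have Gh: "amap G A B h = \<dots>" .
      have "cmp K (omap F A) (omap F B) B b (amap G A B h) =
          cmp K (omap F A) (omap F ?TB) B b' (sharp C T (omap F A) (omap F ?TB) (amap F A ?TB h))"
        unfolding Gh b'_def using category.cmp_assoc[OF category_kleisli] B FA FB FTB l b sharp_hom Fh
        by (simp add: kleisli_simps)
      also have "\<dots> = cmp C (omap F A) (omap F ?TB) ?TB b' (amap F A ?TB h)"
        using FA FTB B b' Fh by (simp add: kleisli_cmp_sharp)
      finally show ?thesis
        using h A B X a e FA
        by (simp add: algebra_hom_def kleisli_simps G_ob kleisli_cmp_sharp)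
    qed (simp add: algebra_hom_def kleisli_simps)
    show ?thesis unfolding eq
      by (rule free_algebra_ex1[OF free])
        (use B b' f in \<open>simp_all add: algebra_def kleisli_simps Th\<close>)
  qed
  then show ?thesis
    using X A a e
    by (simp add: free_algebra_def) (simp add: algebra_def kleisli_simps G_ob sharp_hom FF)
qed

end

section \<open>The Kleisli star as the free monad over the lifting\<close>

theorem theorem4p10:
  fixes C :: "('o, 'm) cat"
    and P :: "('o, 'm) coprod"
    and T :: "('o, 'm) monad_data"
    and F Fbar :: "('o, 'm) endo"
    and S :: "'o \<Rightarrow> 'o"
    and i :: "'o \<Rightarrow> 'm"
  assumes "category C"
    and "binary_coproducts C P"
    and "monad C T"
    and "endofunctor C F"
    and "lifts_to C T F Fbar"
    and "\<And>X. X \<in> Ob C \<Longrightarrow> initial_algebra C (plus_const C P F X) (S X) (i X)"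
  shows "lifts_to C T (star_endo C P F S i) (kleisli_star C P T F Fbar S i)
    \<and> monad (kleisli C T) (kleisli_star_monad C P T F Fbar S i)
    \<and> free_monad_over (kleisli C T) Fbar (kleisli_star_monad C P T F Fbar S i)"
proof -
  interpret category C by fact
  interpret coproduct_category C P by unfold_locales fact
  interpret kleisli_setup C T by unfold_locales fact
  interpret base: star_algebras C P F S i
    by unfold_locales
      (use assms(4,6) free_algebra_of_initial in
        \<open>auto simp: initial_algebra_def algebra_def plus_const_def\<close>)
  let ?Q = "kleisli_coprod C T P" and ?N = "kleisli_star_monad C P T F Fbar S i"
  let ?j = "\<lambda>X. sharp C T (csum P (omap F (S X)) X) (S X) (i X)"
  have G: "endofunctor K Fbar" and G_ob: "\<And>X. X \<in> Ob C \<Longrightarrow> omap Fbar X = omap F X"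
    and G_sharp: "\<And>X Y f. \<lbrakk>X \<in> Ob C; Y \<in> Ob C; f \<in> Hom C X Y\<rbrakk> \<Longrightarrow>
        amap Fbar X Y (sharp C T X Y f) = sharp C T (omap F X) (omap F Y) (amap F X Y f)"
    using assms(5) by (auto simp: lifts_to_def)
  \<comment> \<open>Sharp preserves composition, so the two halves of the Kleisli structure map are
    the sharps of the two halves of \<open>i X\<close>. This is the form in which
    \<open>free_algebra_kleisli\<close> supplies free algebras.\<close>
  have j_op: "cmp K (omap F (S X)) (csum P (omap F (S X)) X) (S X) (?j X)
      (inl ?Q (omap F (S X)) X) = sharp C T (omap F (S X)) (S X) (base.op X)"
    and j_unit: "cmp K X (csum P (omap F (S X)) X) (S X) (?j X) (inr ?Q (omap F (S X)) X) =
      sharp C T X (S X) (star_unit C P F S i X)" if X: "X \<in> Ob C" for X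
    using X by (simp_all add: kleisli_coprod_def sharp_cmp base.star_homs base.op_def star_unit_def)
  have Q_csum: "csum ?Q = csum P" by (simp add: kleisli_coprod_def)
  interpret KC: category K by (rule category_kleisli)
  \<comment> \<open>The same locale again, now in the Kleisli category;
    \<open>lifted.star_map\<close> then characterises the action of the Kleisli star on all Kleisli
    arrows.\<close>
  interpret lifted: star_algebras K ?Q Fbar S ?j
  proof unfold_locales
    fix X assume "X \<in> Ob K"
    then have X: "X \<in> Ob C" by (simp add: kleisli_simps)
    show "S X \<in> Ob K" using X by (simp add: kleisli_simps base.carrier_ob)
    show "?j X \<in> Hom K (csum ?Q (omap Fbar (S X)) X) (S X)"
      using X by (simp add: kleisli_simps Q_csum G_ob base.star_homs sharp_hom)
    show "free_algebra K Fbar X (S X)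
      (cmp K (omap Fbar (S X)) (csum ?Q (omap Fbar (S X)) X) (S X) (?j X) (inl ?Q (omap Fbar (S X)) X))
      (cmp K X (csum ?Q (omap Fbar (S X)) X) (S X) (?j X) (inr ?Q (omap Fbar (S X)) X))"
      using free_algebra_kleisli[OF assms(4,5) X base.free_op[OF X]] X
      by (simp add: Q_csum G_ob base.carrier_ob j_op j_unit)
  qed (use G assms(2) in \<open>simp_all add: binary_coproducts_kleisli\<close>)
  have op_eq: "lifted.op X = sharp C T (omap F (S X)) (S X) (base.op X)"
    and unit_eq: "star_unit K ?Q Fbar S ?j X = sharp C T X (S X) (star_unit C P F S i X)"
    if X: "X \<in> Ob C" for X
    using X by (simp_all add: lifted.op_def star_unit_def[of K] Q_csum G_ob base.carrier_ob j_op j_unit)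
  \<comment> \<open>\<open>Fbar\<close> sends sharp arrows to the sharps of their
    \<open>F\<close>-images, so sharp carries homomorphism squares to homomorphism squares.\<close>
  have sharp_algebra_hom:
    "algebra_hom K Fbar (S X) (lifted.op X) (S Y) (lifted.op Y) (sharp C T (S X) (S Y) h)"
    if X: "X \<in> Ob C" and Y: "Y \<in> Ob C"
      and h: "algebra_hom C F (S X) (base.op X) (S Y) (base.op Y) h" for X Y h
    using X Y h base.op_algebra[OF X] base.op_algebra[OF Y]
    by (simp add: algebra_hom_def algebra_def op_eq kleisli_simps sharp_hom G_ob G_sharp sharp_cmp
        base.star_homs)
  have N_simps: "omap ?N = S" "amap ?N = amap (star_endo K ?Q Fbar S ?j)"
    "mu ?N = (\<lambda>X. sharp C T (S (S X)) (S X) (star_mult C P F S i X))"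
    "eta ?N = (\<lambda>X. sharp C T X (S X) (star_unit C P F S i X))"
    by (simp_all add: kleisli_star_monad_def kleisli_star_def star_endo_def)
  \<comment> \<open>The functor part comes from \<open>lifted.star_map\<close>, but the
    multiplication is the sharp of the one in \<open>C\<close>: it is a homomorphism by
    \<open>sharp_algebra_hom\<close>, and its law on generators is the sharp of the law in
    \<open>C\<close>.\<close>
  interpret N: free_algebra_monad K Fbar ?N lifted.op
  proof (unfold_locales, simp_all only: N_simps kleisli_simps)
    fix X assume X: "X \<in> Ob C"
    show "free_algebra K Fbar X (S X) (lifted.op X) (sharp C T X (S X) (star_unit C P F S i X))"
      using lifted.free_op[of X] X by (simp add: unit_eq kleisli_simps)
    show "algebra_hom K Fbar (S (S X)) (lifted.op (S X)) (S X) (lifted.op X)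
        (sharp C T (S (S X)) (S X) (star_mult C P F S i X))"
      using X base.star_mult(1) by (intro sharp_algebra_hom) (simp_all add: base.carrier_ob)
    show "cmp K (S X) (S (S X)) (S X) (sharp C T (S (S X)) (S X) (star_mult C P F S i X))
        (sharp C T (S X) (S (S X)) (star_unit C P F S i (S X))) = eta T (S X)"
      using X base.star_mult[OF X]
      by (simp add: sharp_cmp base.star_homs algebra_hom_def sharp_ide)
  next
    fix X Y f assume X: "X \<in> Ob C" and Y: "Y \<in> Ob C" and f: "f \<in> Hom C X (omap T Y)"
    show "algebra_hom K Fbar (S X) (lifted.op X) (S Y) (lifted.op Y)
        (amap (star_endo K ?Q Fbar S ?j) X Y f)"
      using lifted.star_map(1)[of X Y f] X Y f by (simp add: kleisli_simps)
    show "cmp K X (S X) (S Y) (amap (star_endo K ?Q Fbar S ?j) X Y f)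
         (sharp C T X (S X) (star_unit C P F S i X)) =
       cmp K X Y (S Y) (sharp C T Y (S Y) (star_unit C P F S i Y)) f"
      using lifted.star_map(2)[of X Y f] X Y f by (simp add: kleisli_simps unit_eq)
  qed (rule G)
  \<comment> \<open>Claim (i): both sides are homomorphisms between the lifted free algebras, and on
    generators both are the sharp of \<open>star_unit\<close> after \<open>f\<close>.\<close>
  have star_sharp: "amap (star_endo K ?Q Fbar S ?j) X Y (sharp C T X Y f) =
      sharp C T (S X) (S Y) (amap (star_endo C P F S i) X Y f)"
    if X: "X \<in> Ob C" and Y: "Y \<in> Ob C" and f: "f \<in> Hom C X Y" for X Y f
  proof (rule KC.free_algebra_hom_eq[OF lifted.free_op[of X] lifted.op_algebra[of Y]])
    show "algebra_hom K Fbar (S X) (lifted.op X) (S Y) (lifted.op Y)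
        (sharp C T (S X) (S Y) (amap (star_endo C P F S i) X Y f))"
      using X Y f base.star_map(1) by (intro sharp_algebra_hom)
    show "cmp K X (S X) (S Y) (amap (star_endo K ?Q Fbar S ?j) X Y (sharp C T X Y f))
        (star_unit K ?Q Fbar S ?j X) =
      cmp K X (S X) (S Y) (sharp C T (S X) (S Y) (amap (star_endo C P F S i) X Y f))
        (star_unit K ?Q Fbar S ?j X)"
      using X Y f base.star_map[OF X Y f] lifted.star_map(2)[of X Y "sharp C T X Y f"]
      by (simp add: kleisli_simps sharp_hom unit_eq sharp_cmp base.star_homs
          algebra_hom_def)
  qed (use X Y f in \<open>simp_all add: kleisli_simps sharp_hom lifted.star_map(1)\<close>)
  \<comment> \<open>The lifting claim includes functoriality of the Kleisli star, which is read off
    from the monad, as both records have the same object and arrow maps.\<close>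
  have "endofunctor K (kleisli_star C P T F Fbar S i)"
    using N.free_functor by (simp add: endofunctor_def kleisli_star_monad_def)
  then have "lifts_to C T (star_endo C P F S i) (kleisli_star C P T F Fbar S i)"
    using star_sharp by (simp add: lifts_to_def kleisli_star_def) (simp add: star_endo_def)
  with N.is_monad N.is_free show ?thesis by blast
qed

end
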